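(* Let $n\ge k\ge1$ and $m=\min\{n-k,k-1\}$. Then $$|\Pi_{n,k}/\sim_{cr}|=\sum_{l=0}^{m}\binom{k-1}{l}\Big[(n-k-1)l-\frac{l(l-1)}{2}+1\Big].$$ In particular, if $n\ge 2k-1$, then $|\Pi_{n,k}/\sim_{cr}|=(n-k-1)(k-1)2^{k-2}+2^{k-1}-(k-1)(k-2)2^{k-4}$.
   Context: $\Pi_{n,k}$ is the set of partitions of $[n]$ with $k$ blocks. Partitions are drawn with arcs joining consecutive elements of each block; $cr(\mu)$ is the number of pairs of arcs $(i_1,j_1),(i_2,j_2)$ with $i_1<i_2<j_1<j_2$. The tree of partitions has root the empty partition, and a partition $\mu$ of $[N+1]$ is a child of a partition $\nu$ of $[N]$ iff the restriction of $\mu$ to $\{2,\dots,N+1\}$ is order-isomorphic to $\nu$; $\mathcal{T}(\lambda,l,m)$ is the set of descendants of $\lambda$ at distance $l$ (i.e. partitions of $[n+l]$ whose restriction to the last $n$ elements is order-isomorphic to $\lambda\in\Pi_n$) having $m$ blocks. For $\lambda,\pi\in\Pi_n$, $\lambda\sim_{cr}\pi$ iff the multisets $\{cr(\mu):\mu\in\mathcal{T}(\lambda,l,m)\}$ and $\{cr(\mu):\mu\in\mathcal{T}(\pi,l,m)\}$ coincide for all $l,m\ge0$. $\Pi_{n,k}/\sim_{cr}$ is the set of equivalence classes of $\sim_{cr}$ restricted to $\Pi_{n,k}$. *)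

theory Defs
  imports Complex_Main "HOL-Library.Disjoint_Sets" "HOL-Library.Multiset"
begin

definition partitions_of :: "nat \<Rightarrow> nat set set set" where
  "partitions_of n = {P. partition_on {1..n} P}"

definition partitions_with_blocks :: "nat \<Rightarrow> nat \<Rightarrow> nat set set set" where
  "partitions_with_blocks n k = {P \<in> partitions_of n. card P = k}"

definition arcs :: "nat set set \<Rightarrow> (nat \<times> nat) set" where
  "arcs P = {(i, j). i < j \<and> (\<exists>B\<in>P. i \<in> B \<and> j \<in> B \<and> (\<forall>x\<in>B. \<not> (i < x \<and> x < j)))}"

definition cr :: "nat set set \<Rightarrow> nat" where
  "cr P = card {((i1, j1), (i2, j2)). (i1, j1) \<in> arcs P \<and> (i2, j2) \<in> arcs P \<and>
                  i1 < i2 \<and> i2 < j1 \<and> j1 < j2}"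

definition restrict_partition :: "nat set set \<Rightarrow> nat set \<Rightarrow> nat set set" where
  "restrict_partition P S = (\<lambda>B. B \<inter> S) ` P - {{}}"

definition order_isomorphic :: "nat set set \<Rightarrow> nat set set \<Rightarrow> bool" where
  "order_isomorphic P Q \<longleftrightarrow> (\<exists>f. strict_mono_on (\<Union>P) f \<and> (\<lambda>B. f ` B) ` P = Q)"

definition is_child :: "nat set set \<Rightarrow> nat set set \<Rightarrow> bool" where
  "is_child \<nu> \<mu> \<longleftrightarrow> (\<exists>N. \<nu> \<in> partitions_of N \<and> \<mu> \<in> partitions_of (N + 1) \<and>
     order_isomorphic (restrict_partition \<mu> {2..N + 1}) \<nu>)"

definition descendants :: "nat set set \<Rightarrow> nat \<Rightarrow> nat \<Rightarrow> nat set set set" where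
  "descendants \<kappa> l m = {\<mu>. (is_child ^^ l) \<kappa> \<mu> \<and> card \<mu> = m}"

text \<open>The sets of descendants of a partition are finite, so that \<^const>\<open>mset_set\<close>, which is
  empty on infinite sets, gives the intended multisets in \<open>cr_equiv\<close> below.\<close>

lemma finite_partitions_of: "finite (partitions_of n)"
proof -
  have "partitions_of n \<subseteq> Pow (Pow {1..n})"
    by (auto simp: partitions_of_def partition_on_def)
  then show ?thesis
    by (rule finite_subset) simp
qed

lemma partitions_of_unique:
  assumes "P \<in> partitions_of n" "P \<in> partitions_of n'"
  shows "n = n'"
proof -
  have "{1..n} = {1..n'}"
    using assms unfolding partitions_of_def partition_on_def by blast
  then have "card {1..n} = card {1..n'}"
    by (rule arg_cong)
  then show ?thesis
    by simp
qed

lemma relpowp_is_child_partitions_of: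
  assumes "P \<in> partitions_of n" "(is_child ^^ l) P Q"
  shows "Q \<in> partitions_of (n + l)"
  using assms(2)
proof (induction l arbitrary: Q)
  case 0
  then show ?case
    using assms(1) by simp
next
  case (Suc l)
  then obtain R where R: "(is_child ^^ l) P R" "is_child R Q"
    by auto
  then obtain N where N: "R \<in> partitions_of N" "Q \<in> partitions_of (N + 1)"
    by (auto simp: is_child_def)
  have "N = n + l"
    using partitions_of_unique[OF N(1) Suc.IH[OF R(1)]] .
  then show ?case
    using N(2) by simp
qed

lemma finite_descendants:
  assumes "P \<in> partitions_of n"
  shows "finite (descendants P l m)"
proof -
  have "descendants P l m \<subseteq> partitions_of (n + l)"
    using relpowp_is_child_partitions_of[OF assms] by (auto simp: descendants_def)
  then show ?thesis
    using finite_partitions_of by (rule finite_subset)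
qed

definition cr_equiv :: "nat set set \<Rightarrow> nat set set \<Rightarrow> bool" where
  "cr_equiv \<kappa> \<pi> \<longleftrightarrow> (\<forall>l m. image_mset cr (mset_set (descendants \<kappa> l m)) =
                          image_mset cr (mset_set (descendants \<pi> l m)))"

definition cr_rel :: "nat \<Rightarrow> nat \<Rightarrow> (nat set set \<times> nat set set) set" where
  "cr_rel n k = {(\<kappa>, \<pi>). \<kappa> \<in> partitions_with_blocks n k \<and>
                         \<pi> \<in> partitions_with_blocks n k \<and> cr_equiv \<kappa> \<pi>}"

end

theory Submission
  imports Defs "HOL-Computational_Algebra.Polynomial"
begin

text \<open>For a partition with block minima \<open>b\<^sub>1 < \<dots> < b\<^sub>k\<close> let \<open>c\<^sub>i\<close> be the number of arcs covering
  \<open>b\<^sub>i\<close>. Adding a new least element as a singleton prepends a \<open>0\<close> to \<open>c\<close>; joining it to the block of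
  \<open>b\<^sub>i\<close> creates \<open>c\<^sub>i\<close> crossings, deletes \<open>c\<^sub>i\<close>, increases \<open>c\<^sub>1, \<dots>, c\<^bsub>i-1\<^esub>\<close> by one and prepends a
  \<open>0\<close>. Hence the crossing distribution over the descendants is \<open>q\<close> to the number of crossings times a
  polynomial depending on \<open>c\<close> only. This polynomial is affine in each \<open>q ^ c\<^sub>i\<close>, which makes it
  symmetric in \<open>c\<close>; and the children alone recover the multiset of the \<open>c\<^sub>i\<close>. So the classes are the
  pairs of a crossing number and a multiset of covering numbers. As \<open>c\<^sub>1 = 0\<close> and
  \<open>c\<^bsub>i+1\<^esub> \<le> c\<^sub>i + 1\<close>, the values form some \<open>{0..l}\<close>, giving \<open>k - 1 choose l\<close> multisets, and for each
  of them the possible crossing numbers are \<open>0, \<dots>, (n - k) l - l (l + 1) / 2\<close>.\<close>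

section \<open>Symmetry of the extension polynomial\<close>

text \<open>Generating function, by crossings gained, of the \<open>l\<close>-fold extensions with \<open>m\<close> blocks of a
  partition whose block minima are covered by \<open>c ! 0, c ! 1, \<dots>\<close> arcs: the new least element is
  either a singleton or is joined to the \<open>i\<close>-th block.\<close>

fun extension_poly :: "nat \<Rightarrow> nat \<Rightarrow> nat list \<Rightarrow> int poly" where
  "extension_poly 0 m c = (if length c = m then 1 else 0)"
| "extension_poly (Suc l) m c = extension_poly l m (0 # c) +
     (\<Sum>i<length c. monom 1 (c ! i) *
        extension_poly l m (0 # map Suc (take i c) @ drop (Suc i) c))"

lemma sum_lessThan_length_append_Cons:
  fixes g :: "nat \<Rightarrow> 'a::comm_monoid_add"
  shows "(\<Sum>i<length (p @ t # s). g i) =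
    (\<Sum>i<length p. g i) + g (length p) + (\<Sum>i<length s. g (Suc (length p + i)))"
proof -
  have "(\<Sum>i<a + Suc b. g i) = (\<Sum>i<a. g i) + g a + (\<Sum>i<b. g (Suc (a + i)))" for a b
    by (induction b) (simp_all add: ac_simps)
  then show ?thesis by simp
qed

text \<open>A join at an earlier block leaves \<open>t\<close> alone, a join at \<open>t\<close>
  deletes it, and a join at a later block raises it. These three cases drive both inductions
  below.\<close>

lemma extension_poly_Suc_append_Cons:
  "extension_poly (Suc l) m (p @ t # s) = extension_poly l m (0 # p @ t # s) +
     (\<Sum>i<length p. monom 1 (p ! i) *
        extension_poly l m (0 # map Suc (take i p) @ drop (Suc i) p @ t # s)) +
     monom 1 t * extension_poly l m (0 # map Suc p @ s) +
     (\<Sum>i<length s. monom 1 (s ! i) *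
        extension_poly l m ((0 # map Suc p) @ Suc t # map Suc (take i s) @ drop (Suc i) s))"
proof -
  have "extension_poly (Suc l) m (p @ t # s) = extension_poly l m (0 # p @ t # s) +
     (\<Sum>i<length (p @ t # s). monom 1 ((p @ t # s) ! i) *
        extension_poly l m (0 # map Suc (take i (p @ t # s)) @ drop (Suc i) (p @ t # s)))"
    by simp
  then show ?thesis
    unfolding sum_lessThan_length_append_Cons
    by (simp add: nth_append add.assoc)
qed

text \<open>In other words, the polynomial is affine in \<open>q ^ t\<close> for each entry \<open>t\<close>.\<close>

lemma extension_poly_diff:
  "\<exists>C. \<forall>t. extension_poly l m (p @ t # s) - extension_poly l m (p @ Suc t # s) = monom 1 t * C"
proof (induction l arbitrary: p s)
  case 0
  show ?case by (rule exI[of _ 0]) simp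
next
  case (Suc l)
  \<comment> \<open>The constant is chosen before \<open>t\<close>; as a function of the context
    \<open>p\<close>, \<open>s\<close> it can be used under the sums.\<close>
  obtain C where C: "\<And>p s t. extension_poly l m (p @ t # s) =
      extension_poly l m (p @ Suc t # s) + monom 1 t * C p s"
    using Suc.IH by (metis add.commute diff_eq_eq)
  \<comment> \<open>Once the entry is deleted, nothing depends on \<open>t\<close> except its own
    monomial, hence the factor 1 - q. Joins at later blocks compare \<open>Suc t\<close> with
    \<open>Suc (Suc t)\<close>, hence the extra q.\<close>
  define D where "D = C (0 # p) s
     + (\<Sum>i<length p. monom 1 (p ! i) * C (0 # map Suc (take i p) @ drop (Suc i) p) s)
     + (1 - monom 1 1) * extension_poly l m (0 # map Suc p @ s)
     + (\<Sum>i<length s. monom 1 (s ! i) * (monom 1 1 *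
          C (0 # map Suc p) (map Suc (take i s) @ drop (Suc i) s)))"
  have m: "monom 1 (Suc t) = monom 1 t * (monom 1 1 :: int poly)" for t
    by (simp add: mult_monom)
  have "extension_poly (Suc l) m (p @ t # s) - extension_poly (Suc l) m (p @ Suc t # s)
      = monom 1 t * D" for t
  proof -
    have 1: "extension_poly l m (0 # p @ t # s) - extension_poly l m (0 # p @ Suc t # s)
        = monom 1 t * C (0 # p) s"
      using C[of "0 # p" t s] by simp
    have 2: "(\<Sum>i<length p. monom 1 (p ! i) *
        extension_poly l m (0 # map Suc (take i p) @ drop (Suc i) p @ t # s))
      - (\<Sum>i<length p. monom 1 (p ! i) *
        extension_poly l m (0 # map Suc (take i p) @ drop (Suc i) p @ Suc t # s))
      = monom 1 t * (\<Sum>i<length p. monom 1 (p ! i) * C (0 # map Suc (take i p) @ drop (Suc i) p) s)"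
      unfolding sum_subtractf[symmetric] sum_distrib_left
      by (intro sum.cong refl)
        (use C[of "0 # map Suc (take i p) @ drop (Suc i) p" t s for i] in
          \<open>simp add: algebra_simps\<close>)
    have 3: "(\<Sum>i<length s. monom 1 (s ! i) *
        extension_poly l m ((0 # map Suc p) @ Suc t # map Suc (take i s) @ drop (Suc i) s))
      - (\<Sum>i<length s. monom 1 (s ! i) *
        extension_poly l m ((0 # map Suc p) @ Suc (Suc t) # map Suc (take i s) @ drop (Suc i) s))
      = monom 1 t * (\<Sum>i<length s. monom 1 (s ! i) * (monom 1 1 *
          C (0 # map Suc p) (map Suc (take i s) @ drop (Suc i) s)))"
      unfolding sum_subtractf[symmetric] sum_distrib_left C[of "0 # map Suc p" "Suc t"] m
      by (intro sum.cong refl) (simp add: algebra_simps)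
    show ?thesis
      unfolding extension_poly_Suc_append_Cons D_def distrib_left
        1[symmetric] 2[symmetric] 3[symmetric] m
      by (simp add: algebra_simps)
  qed
  then show ?case by blast
qed

text \<open>Only the joins at the two swapped entries need more than the induction hypothesis.
  Together they give q^a X(b) + q^b X(a+1), and affinity of X makes this symmetric in a and
  b.\<close>

lemma extension_poly_swap:
  "extension_poly l m (p @ a # b # s) = extension_poly l m (p @ b # a # s)"
proof (induction l arbitrary: p a b s)
  case 0
  show ?case by simp
next
  case (Suc l)
  define X where "X t = extension_poly l m ((0 # map Suc p) @ t # s)" for t
  obtain C where C: "\<And>t. X t - X (Suc t) = monom 1 t * C"
    unfolding X_def using extension_poly_diff[of l m "0 # map Suc p" s] by blast
  have 1: "extension_poly (Suc l) m (p @ a # b # s) = extension_poly l m ((0 # p) @ a # b # s) +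
     (\<Sum>i<length p. monom 1 (p ! i) *
        extension_poly l m ((0 # map Suc (take i p) @ drop (Suc i) p) @ a # b # s)) +
     (monom 1 a * X b + monom 1 b * X (Suc a)) +
     (\<Sum>i<length s. monom 1 (s ! i) * extension_poly l m
        ((0 # map Suc p) @ Suc a # Suc b # map Suc (take i s) @ drop (Suc i) s))" for a b
    unfolding extension_poly_Suc_append_Cons X_def
    by (simp add: sum.lessThan_Suc_shift add.assoc del: sum.lessThan_Suc)
  \<comment> \<open>Both sides equal q^(a+b) times \<open>C\<close>.\<close>
  have "monom 1 a * (X b - X (Suc b)) = monom 1 b * (X a - X (Suc a))"
    unfolding C by (simp add: ac_simps)
  then have "monom 1 a * X b + monom 1 b * X (Suc a) = monom 1 b * X a + monom 1 a * X (Suc b)"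
    by (simp add: algebra_simps)
  then show ?case
    unfolding 1 Suc.IH[of _ b a] Suc.IH[of _ "Suc b" "Suc a"] by simp
qed

lemma extension_poly_move:
  "extension_poly l m (p @ x # q @ s) = extension_poly l m (p @ q @ x # s)"
proof (induction q arbitrary: p)
  case (Cons y q)
  have "extension_poly l m (p @ x # y # q @ s) = extension_poly l m ((p @ [y]) @ x # q @ s)"
    using extension_poly_swap by simp
  also have "\<dots> = extension_poly l m ((p @ [y]) @ q @ x # s)"
    by (rule Cons.IH)
  finally show ?case by simp
qed simp

lemma extension_poly_cong_mset:
  assumes "mset c = mset d"
  shows "extension_poly l m c = extension_poly l m d"
proof -
  \<comment> \<open>The prefix \<open>p\<close> collects the entries that are already matched; the
    next entry of \<open>c\<close> is located in \<open>d\<close> and moved to the front.\<close>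
  have "extension_poly l m (p @ c) = extension_poly l m (p @ d)" for p
    using assms
  proof (induction c arbitrary: p d)
    case (Cons x c)
    then have "x \<in> set d"
      by (metis list.set_intros(1) mset_eq_setD)
    then obtain q s where d: "d = q @ x # s"
      by (meson split_list)
    with Cons.prems have "mset c = mset (q @ s)" by simp
    from Cons.IH[OF this, of "p @ [x]"] show ?case
      using extension_poly_move[of l m p x q s] by (simp add: d)
  qed simp
  from this[of "[]"] show ?thesis by simp
qed

section \<open>Adding a least element to a partition\<close>

definition shift :: "nat set set \<Rightarrow> nat set set" where
  "shift P = (`) Suc ` P"

text \<open>The new least element is added as \<open>0\<close>; \<^const>\<open>shift\<close> then restores the ground set
  \<open>{1..n + 1}\<close>.\<close>

definition add_singleton :: "nat set set \<Rightarrow> nat set set" where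
  "add_singleton P = insert {0} P"

definition add_to_block :: "nat set set \<Rightarrow> nat set \<Rightarrow> nat set set" where
  "add_to_block P B = insert (insert 0 B) (P - {B})"

definition covering :: "nat set set \<Rightarrow> nat \<Rightarrow> nat" where
  "covering P x = card {(i, j) \<in> arcs P. i < x \<and> x < j}"

definition covering_seq :: "nat set set \<Rightarrow> nat list" where
  "covering_seq P = map (covering P) (sorted_list_of_set (Min ` P))"

section \<open>Invariance of crossings and covering numbers under the shift\<close>

lemma inj_image_Suc: "inj ((`) Suc)"
  by (simp add: inj_image_eq_iff inj_def)

lemma Suc_Suc_in_arcs_shift: "(Suc i, Suc j) \<in> arcs (shift P) \<longleftrightarrow> (i, j) \<in> arcs P"
  by (auto simp: arcs_def shift_def)

lemma arcs_shift_pos: "(i, j) \<in> arcs (shift P) \<Longrightarrow> 0 < i \<and> 0 < j"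
  by (auto simp: arcs_def shift_def)

lemma arcs_shiftD: "(i, j) \<in> arcs (shift P) \<Longrightarrow> \<exists>a b. i = Suc a \<and> j = Suc b \<and> (a, b) \<in> arcs P"
  by (metis Suc_Suc_in_arcs_shift arcs_shift_pos gr0_conv_Suc)

lemma cr_shift: "cr (shift P) = cr P"
proof -
  let ?f = "map_prod (map_prod Suc Suc) (map_prod Suc Suc)"
  \<comment> \<open>Truncated subtraction inverts \<open>Suc\<close> here because arcs of a shifted
    partition have positive endpoints.\<close>
  let ?g = "map_prod (map_prod (\<lambda>x. x - 1) (\<lambda>x. x - 1)) (map_prod (\<lambda>x. x - 1) (\<lambda>x. x - 1))"
  let ?X = "\<lambda>P. {((i1, j1), (i2, j2)). (i1, j1) \<in> arcs P \<and> (i2, j2) \<in> arcs P \<and>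
      i1 < i2 \<and> i2 < j1 \<and> j1 < j2}"
  have "bij_betw ?f (?X P) (?X (shift P))"
  proof (rule bij_betw_byWitness[where f' = ?g])
    show "\<forall>x\<in>?X P. ?g (?f x) = x" by auto
    show "\<forall>x\<in>?X (shift P). ?f (?g x) = x" by (auto dest: arcs_shift_pos)
    show "?f ` ?X P \<subseteq> ?X (shift P)" by (auto simp: Suc_Suc_in_arcs_shift)
    show "?g ` ?X (shift P) \<subseteq> ?X P"
      by (fastforce dest: arcs_shiftD)
  qed
  then show ?thesis
    unfolding cr_def by (rule bij_betw_same_card[symmetric])
qed

lemma covering_shift: "covering (shift P) (Suc x) = covering P x"
proof -
  let ?f = "map_prod Suc Suc" and ?g = "map_prod (\<lambda>x. x - 1) (\<lambda>x. x - 1)"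
  let ?X = "{(i, j) \<in> arcs P. i < x \<and> x < j}"
    and ?Y = "{(i, j) \<in> arcs (shift P). i < Suc x \<and> Suc x < j}"
  have "bij_betw ?f ?X ?Y"
  proof (rule bij_betw_byWitness[where f' = ?g])
    show "\<forall>x\<in>?X. ?g (?f x) = x" by auto
    show "\<forall>x\<in>?Y. ?f (?g x) = x" by (auto dest: arcs_shift_pos)
    show "?f ` ?X \<subseteq> ?Y" by (auto simp: Suc_Suc_in_arcs_shift)
    show "?g ` ?Y \<subseteq> ?X"
      by (fastforce dest: arcs_shiftD)
  qed
  then show ?thesis
    unfolding covering_def by (rule bij_betw_same_card[symmetric])
qed

lemma sorted_list_of_set_image_Suc:
  "sorted_list_of_set (Suc ` A) = map Suc (sorted_list_of_set A)"
proof (cases "finite A")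
  case True
  then show ?thesis
    by (intro strict_sorted_equal) (auto simp: sorted_wrt_map)
qed (simp add: finite_image_iff)

lemma Min_image_Suc: "finite B \<Longrightarrow> B \<noteq> {} \<Longrightarrow> Min (Suc ` B) = Suc (Min B)"
  by (intro Min_eqI) auto

section \<open>Adding 0 to a partition of a finite set of positive numbers\<close>

locale pos_partition =
  fixes A :: "nat set" and P :: "nat set set"
  assumes part: "partition_on A P" and fin: "finite A" and pos: "0 \<notin> A"
begin

lemma finite_P: "finite P"
  using finite_elements[OF fin part] .

lemma block: "B \<in> P \<Longrightarrow> finite B \<and> B \<noteq> {} \<and> 0 \<notin> B"
  using part fin pos unfolding partition_on_def by (auto intro: finite_subset)

lemma Min_block: "B \<in> P \<Longrightarrow> Min B \<in> B"
  using block by auto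

lemma block_unique: "B \<in> P \<Longrightarrow> C \<in> P \<Longrightarrow> x \<in> B \<Longrightarrow> x \<in> C \<Longrightarrow> B = C"
  using part unfolding partition_on_def disjoint_def by auto

lemma inj_on_Min: "inj_on Min P"
  using block_unique Min_block by (metis inj_onI)

lemma arcs_subset: "arcs P \<subseteq> A \<times> A"
  using part unfolding arcs_def partition_on_def by auto

lemma finite_arcs: "finite (arcs P)"
  using finite_subset[OF arcs_subset] fin by simp

lemma arcs_pos: "(i, j) \<in> arcs P \<Longrightarrow> 0 < i"
  using arcs_subset pos by (auto intro: gr0I)

lemma length_covering_seq: "length (covering_seq P) = card P"
  by (simp add: covering_seq_def card_image inj_on_Min)

lemma arcs_add_singleton: "arcs (add_singleton P) = arcs P"
  unfolding arcs_def add_singleton_def by auto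

text \<open>In the enlarged block 0 is followed by the old minimum; all other consecutive pairs stay
  as they were.\<close>

lemma arcs_add_to_block:
  assumes B: "B \<in> P"
  shows "arcs (add_to_block P B) = insert (0, Min B) (arcs P)" (is "?L = ?R")
proof (intro equalityI subrelI)
  fix i j assume "(i, j) \<in> ?L"
  then obtain C where C: "i < j" "C \<in> add_to_block P B" "i \<in> C" "j \<in> C"
    "\<forall>x\<in>C. \<not> (i < x \<and> x < j)" by (auto simp: arcs_def)
  show "(i, j) \<in> ?R"
  proof (cases "C = insert 0 B")
    case True
    show ?thesis
    proof (cases "i = 0")
      case True
      with C \<open>C = _\<close> have "j \<in> B" "\<forall>x\<in>B. \<not> x < j" using block[OF B] by auto
      then have "Min B = j"
        using block[OF B] by (intro Min_eqI) (auto simp: not_less)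
      then show ?thesis using True by simp
    next
      case False
      then show ?thesis using C B \<open>C = _\<close> by (auto simp: arcs_def)
    qed
  next
    case False
    then show ?thesis using C by (auto simp: arcs_def add_to_block_def)
  qed
next
  fix i j assume "(i, j) \<in> ?R"
  then consider "i = 0" "j = Min B" | C where "i < j" "C \<in> P" "i \<in> C" "j \<in> C"
    "\<forall>x\<in>C. \<not> (i < x \<and> x < j)" by (auto simp: arcs_def)
  then show "(i, j) \<in> ?L"
  proof cases
    case 1
    have "Min B > 0" using Min_block[OF B] block[OF B] by (metis gr0I)
    moreover have "\<forall>x\<in>B. \<not> x < Min B" using block[OF B] by auto
    ultimately show ?thesis using 1 Min_block[OF B] by (auto simp: arcs_def add_to_block_def)
  next
    case 2
    then show ?thesis
      by (cases "C = B") (auto simp: arcs_def add_to_block_def)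
  qed
qed

lemma cr_add_singleton: "cr (add_singleton P) = cr P"
  by (simp add: cr_def arcs_add_singleton)

text \<open>The new arc starts to the left of all others, so it can only be the first arc of a
  crossing, and it crosses exactly the arcs that cover \<open>Min B\<close>.\<close>

lemma cr_add_to_block:
  assumes B: "B \<in> P"
  shows "cr (add_to_block P B) = cr P + covering P (Min B)"
proof -
  let ?X = "{((i1, j1), (i2, j2)). (i1, j1) \<in> arcs P \<and> (i2, j2) \<in> arcs P \<and>
          i1 < i2 \<and> i2 < j1 \<and> j1 < j2}"
  let ?Y = "{(i, j) \<in> arcs P. i < Min B \<and> Min B < j}"
  have "{((i1, j1), (i2, j2)). (i1, j1) \<in> arcs (add_to_block P B) \<and>
          (i2, j2) \<in> arcs (add_to_block P B) \<and> i1 < i2 \<and> i2 < j1 \<and> j1 < j2}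
      = ?X \<union> Pair (0, Min B) ` ?Y"
    unfolding arcs_add_to_block[OF B] using arcs_pos by (fastforce simp: image_iff)
  moreover have "?X \<inter> Pair (0, Min B) ` ?Y = {}"
    using arcs_pos by fastforce
  moreover have "finite ?X"
    by (rule finite_subset[of _ "arcs P \<times> arcs P"]) (auto simp: finite_arcs)
  moreover have "finite ?Y"
    by (rule finite_subset[of _ "arcs P"]) (auto simp: finite_arcs)
  ultimately show ?thesis
    unfolding cr_def covering_def by (simp add: card_Un_disjoint card_image inj_on_def)
qed

lemma covering_add_singleton: "covering (add_singleton P) x = covering P x"
  by (simp add: covering_def arcs_add_singleton)

lemma covering_0: "covering P 0 = 0"
  by (simp add: covering_def)

lemma covering_add_to_block:
  assumes B: "B \<in> P"
  shows "covering (add_to_block P B) x =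
    (if 0 < x \<and> x < Min B then Suc (covering P x) else covering P x)"
proof -
  let ?Y = "{(i, j) \<in> arcs P. i < x \<and> x < j}"
  have fin: "finite ?Y"
    by (rule finite_subset[of _ "arcs P"]) (auto simp: finite_arcs)
  have "{(i, j) \<in> arcs (add_to_block P B). i < x \<and> x < j} =
    (if 0 < x \<and> x < Min B then insert (0, Min B) ?Y else ?Y)"
    unfolding arcs_add_to_block[OF B] by auto
  moreover have "(0, Min B) \<notin> ?Y" using arcs_pos by auto
  ultimately show ?thesis
    using fin unfolding covering_def by (cases "0 < x \<and> x < Min B") (simp_all only: card_insert_disjoint simp_thms if_True if_False)
qed

lemma Min_image_pos: "b \<in> Min ` P \<Longrightarrow> 0 < b"
  using Min_block block by (metis gr0I imageE)

lemma sorted_list_of_set_insert_0: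
  assumes "M \<subseteq> Min ` P"
  shows "sorted_list_of_set (insert 0 M) = 0 # sorted_list_of_set M"
proof -
  have "finite M" using assms finite_P by (auto intro: finite_subset)
  moreover have "x > 0" if "x \<in> M" for x using that assms Min_image_pos by blast
  ultimately show ?thesis
    by (intro strict_sorted_equal) (auto simp del: sorted_list_of_set_insert_remove)
qed

lemma Min_image_add_singleton: "Min ` add_singleton P = insert 0 (Min ` P)"
  by (simp add: add_singleton_def)

lemma Min_image_add_to_block:
  assumes B: "B \<in> P"
  shows "Min ` add_to_block P B = insert 0 (Min ` P - {Min B})"
proof -
  have "Min (insert 0 B) = 0" using block[OF B] by (intro Min_eqI) auto
  moreover have "Min ` (P - {B}) = Min ` P - {Min B}"
    using inj_on_image_set_diff[OF inj_on_Min, of P "{B}"] B by simp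
  ultimately show ?thesis by (simp add: add_to_block_def)
qed

lemma covering_seq_add_singleton: "covering_seq (add_singleton P) = 0 # covering_seq P"
  unfolding covering_seq_def Min_image_add_singleton sorted_list_of_set_insert_0[OF order_refl]
  by (simp add: covering_add_singleton covering_0 cong: map_cong)

text \<open>Minima before \<open>Min B\<close> lie under the new arc, later ones do not.
  \<open>Min B\<close> is no longer a minimum, and 0, covered by nothing, becomes the first
  one.\<close>

lemma covering_seq_add_to_block:
  assumes B: "B \<in> P" and L: "sorted_list_of_set (Min ` P) = p @ Min B # s"
  shows "covering_seq (add_to_block P B) =
    0 # map Suc (map (covering P) p) @ map (covering P) s"
proof -
  have sorted: "sorted_wrt (<) (p @ Min B # s)"
    unfolding L[symmetric] by simp
  have set: "set (p @ Min B # s) = Min ` P"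
    unfolding L[symmetric] using finite_P by simp
  have "sorted_list_of_set (Min ` P - {Min B}) = remove1 (Min B) (p @ Min B # s)"
    unfolding L[symmetric] using finite_P by (simp add: sorted_list_of_set.sorted_key_list_of_set_remove)
  also have "\<dots> = p @ s"
    using sorted by (auto simp: sorted_wrt_append remove1_append)
  finally have "sorted_list_of_set (insert 0 (Min ` P - {Min B})) = 0 # p @ s"
    by (subst sorted_list_of_set_insert_0) auto
  moreover have "map (covering (add_to_block P B)) p = map Suc (map (covering P) p)"
  proof -
    have "0 < x \<and> x < Min B" if "x \<in> set p" for x
      using that sorted set Min_image_pos by (auto simp: sorted_wrt_append)
    then show ?thesis by (simp add: covering_add_to_block[OF B])
  qed
  moreover have "map (covering (add_to_block P B)) s = map (covering P) s"
  proof -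
    have "Min B < x" if "x \<in> set s" for x
      using that sorted by (auto simp: sorted_wrt_append)
    then show ?thesis by (fastforce simp: covering_add_to_block[OF B])
  qed
  ultimately show ?thesis
    by (simp add: covering_seq_def Min_image_add_to_block[OF B] covering_add_to_block[OF B] covering_0)
qed

lemma partition_on_add_singleton: "partition_on (insert 0 A) (add_singleton P)"
  using part pos unfolding add_singleton_def partition_on_def
  by (auto simp: pairwise_insert disjnt_def)

lemma partition_on_add_to_block:
  assumes B: "B \<in> P"
  shows "partition_on (insert 0 A) (add_to_block P B)"
proof -
  have "\<Union> (add_to_block P B) = insert 0 (\<Union> P)"
    using B by (auto simp: add_to_block_def)
  moreover have "disjoint (add_to_block P B)"
  proof (rule disjointI)
    fix C D assume "C \<in> add_to_block P B" "D \<in> add_to_block P B" "C \<noteq> D"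
    then show "C \<inter> D = {}"
      using block_unique[OF B, of C] block_unique[OF B, of D] block_unique[of C D]
        block[of C] block[of D]
      by (auto simp: add_to_block_def)
  qed
  ultimately show ?thesis
    using part by (auto simp: partition_on_def add_to_block_def)
qed

end

lemma covering_seq_shift:
  assumes "\<And>B. B \<in> P \<Longrightarrow> finite B \<and> B \<noteq> {}"
  shows "covering_seq (shift P) = covering_seq P"
proof -
  have "Min ` shift P = Suc ` Min ` P"
    unfolding shift_def image_image using assms by (intro image_cong) (auto simp: Min_image_Suc)
  then show ?thesis
    by (simp add: covering_seq_def sorted_list_of_set_image_Suc covering_shift)
qed

lemma partition_on_shift:
  assumes "partition_on A P"
  shows "partition_on (Suc ` A) (shift P)"
proof -
  have "(`) Suc ` P - {{}} = shift P"
    using assms by (auto simp: shift_def partition_on_def)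
  then show ?thesis
    using partition_on_inj_image[OF assms, of Suc] by simp
qed

lemma pos_partitionI: "P \<in> partitions_of n \<Longrightarrow> pos_partition {1..n} P"
  by (simp add: pos_partition_def partitions_of_def)

lemma shift_insert_0:
  assumes "partition_on (insert 0 {1..n}) Q"
  shows "shift Q \<in> partitions_of (Suc n)" "covering_seq (shift Q) = covering_seq Q"
proof -
  have "Suc ` insert 0 {1..n} = {1..Suc n}"
    by (simp add: image_Suc_atLeastAtMost atLeastAtMost_insertL)
  then show "shift Q \<in> partitions_of (Suc n)"
    using partition_on_shift[OF assms] by (simp add: partitions_of_def)
  have "finite B \<and> B \<noteq> {}" if "B \<in> Q" for B
    using assms that finite_subset[of B "insert 0 {1..n}"] unfolding partition_on_def by auto
  then show "covering_seq (shift Q) = covering_seq Q"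
    by (rule covering_seq_shift)
qed

lemma shift_inject: "shift P = shift Q \<longleftrightarrow> P = Q"
  by (simp add: shift_def inj_image_eq_iff[OF inj_image_Suc])

section \<open>The children of a partition\<close>

lemma strict_mono_on_shift_down:
  assumes f: "strict_mono_on {2..N + 1} f" and im: "f ` {2..N + 1} = {1..N}" and x: "x \<in> {2..N + 1}"
  shows "f x = x - (1 :: nat)"
proof (rule antisym)
  \<comment> \<open>Strict growth from the left end of the domain gives the lower bound; the same
    argument from the right end gives the upper bound.\<close>
  have lower: "i + 1 \<le> f (i + 2)" if "i + 2 \<le> N + 1" for i
    using that
  proof (induction i)
    case 0
    then have "f (0 + 2) \<in> {1..N}" using im by auto
    then show ?case unfolding atLeastAtMost_iff by linarith
  next
    case (Suc i)
    have "f (i + 2) < f (Suc i + 2)"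
      using Suc.prems by (intro strict_mono_onD[OF f]) auto
    with Suc show ?case by simp
  qed
  have upper: "f (N + 1 - i) + i \<le> N" if "2 \<le> N + 1 - i" for i
    using that
  proof (induction i)
    case 0
    then have "f (N + 1) \<in> {1..N}" using im by auto
    then show ?case by simp
  next
    case (Suc i)
    have "f (N + 1 - Suc i) < f (N + 1 - i)"
      using Suc.prems by (intro strict_mono_onD[OF f]) auto
    moreover have "f (N + 1 - i) + i \<le> N"
      using Suc by simp
    ultimately show ?case by linarith
  qed
  show "f x \<le> x - 1" using upper[of "N + 1 - x"] x by auto
  have "x - 2 + 2 = x" using x unfolding atLeastAtMost_iff by linarith
  then show "x - 1 \<le> f x" using lower[of "x - 2"] x by simp
qed

text \<open>The order isomorphism can only be the decrement, so the existential in
  \<open>is_child\<close> turns into an equation of set partitions.\<close>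

lemma is_child_iff:
  assumes P: "P \<in> partitions_of N"
  shows "is_child P Q \<longleftrightarrow> Q \<in> partitions_of (N + 1) \<and> restrict_partition Q {2..N + 1} = shift P"
proof -
  have UP: "\<Union> P = {1..N}" using P by (auto simp: partitions_of_def partition_on_def)
  have "order_isomorphic (restrict_partition Q {2..N + 1}) P \<longleftrightarrow>
      restrict_partition Q {2..N + 1} = shift P" if Q: "Q \<in> partitions_of (N + 1)"
  proof
    let ?R = "restrict_partition Q {2..N + 1}"
    have UQ: "\<Union> Q = {1..N + 1}" using Q by (auto simp: partitions_of_def partition_on_def)
    have "\<Union> ?R = \<Union> Q \<inter> {2..N + 1}"
      unfolding restrict_partition_def by auto
    then have UR: "\<Union> ?R = {2..N + 1}" unfolding UQ by auto
    {
      assume "order_isomorphic ?R P"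
      then obtain f where f: "strict_mono_on {2..N + 1} f" "(`) f ` ?R = P"
        unfolding order_isomorphic_def UR by auto
      have "f ` {2..N + 1} = {1..N}"
        using UR UP f(2) by (metis image_Union)
      then have fx: "Suc (f x) = x" if "x \<in> {2..N + 1}" for x
        using strict_mono_on_shift_down[OF f(1) _ that] that by simp
      have "Suc ` f ` B = B" if "B \<in> ?R" for B
      proof -
        have "B \<subseteq> {2..N + 1}" using that UR by blast
        then have "(\<lambda>x. Suc (f x)) ` B = (\<lambda>x. x) ` B"
          using fx by (intro image_cong) auto
        then show ?thesis by (simp add: image_image)
      qed
      then show "?R = shift P"
        unfolding shift_def f(2)[symmetric] image_image by simp
    next
      assume R: "?R = shift P"
      have "strict_mono_on {2..N + 1} (\<lambda>x. x - 1 :: nat)"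
        by (auto simp: strict_mono_on_def)
      moreover have "(`) (\<lambda>x. x - 1) ` shift P = P"
        by (simp add: shift_def image_image)
      ultimately show "order_isomorphic ?R P"
        unfolding order_isomorphic_def UR
        by (intro exI[of _ "\<lambda>x. x - 1"]) (simp only: R)
    }
  qed
  moreover have "M = N" if "P \<in> partitions_of M" for M
    using partitions_of_unique[OF that P] .
  ultimately show ?thesis
    unfolding is_child_def using P by metis
qed

text \<open>Restricting after the shift amounts to deleting 0 before it; the empty set to be
  discarded comes from a singleton block {0}.\<close>

lemma restrict_shift:
  assumes "\<Union> Q \<subseteq> insert 0 {1..N}" "{} \<notin> Q"
  shows "restrict_partition (shift Q) {2..N + 1} = shift ((\<lambda>B. B - {0}) ` Q - {{}})"
proof -
  have "Suc ` B \<inter> {2..N + 1} = Suc ` (B - {0})" if "B \<in> Q" for B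
    using assms that by (fastforce simp: image_iff)
  then have "(\<lambda>B. B \<inter> {2..N + 1}) ` shift Q = (\<lambda>B. Suc ` (B - {0})) ` Q"
    unfolding shift_def image_image by (intro image_cong) auto
  then have "restrict_partition (shift Q) {2..N + 1} = (`) Suc ` (\<lambda>B. B - {0}) ` Q - {{}}"
    unfolding restrict_partition_def by (simp add: image_image)
  also have "\<dots> = (`) Suc ` ((\<lambda>B. B - {0}) ` Q - {{}})"
    by (subst image_set_diff[OF inj_image_Suc]) simp
  finally show ?thesis by (simp add: shift_def)
qed

lemma ex_shift:
  assumes "Q \<in> partitions_of (N + 1)"
  shows "\<exists>R. Q = shift R \<and> partition_on (insert 0 {1..N}) R"
proof -
  let ?R = "(`) (\<lambda>x. x - 1) ` Q"
  have Q: "partition_on {1..N + 1} Q" using assms by (simp add: partitions_of_def)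
  have "inj_on (\<lambda>x. x - 1) {1..N + 1}" by (auto simp: inj_on_def)
  moreover have "(\<lambda>x. x - 1) ` {1..N + 1} = insert 0 {1..N}"
    by (force simp: image_iff intro: bexI[of _ "Suc x" for x])
  moreover have "?R - {{}} = ?R" using Q by (auto simp: partition_on_def)
  ultimately have "partition_on (insert 0 {1..N}) ?R"
    using partition_on_inj_image[OF Q, of "\<lambda>x. x - 1"] by simp
  moreover have "Suc ` (\<lambda>x. x - 1) ` B = B" if "B \<in> Q" for B
  proof -
    have "B \<subseteq> {1..N + 1}" using Q that by (auto simp: partition_on_def)
    then have "(\<lambda>x. Suc (x - 1)) ` B = (\<lambda>x. x) ` B"
      by (intro image_cong) auto
    then show ?thesis by (simp add: image_image)
  qed
  then have "Q = shift ?R" unfolding shift_def image_image by simp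
  ultimately show ?thesis by blast
qed

text \<open>The cases come from the block of \<open>R\<close> that contains 0: either it is {0}, or
  it becomes a block of \<open>P\<close> when 0 is deleted.\<close>

lemma remove_0_eq_iff:
  assumes P: "partition_on {1..N} P" and R: "partition_on (insert 0 {1..N}) R"
  shows "(\<lambda>B. B - {0}) ` R - {{}} = P \<longleftrightarrow> R = add_singleton P \<or> (\<exists>B\<in>P. R = add_to_block P B)"
proof
  assume eq: "(\<lambda>B. B - {0}) ` R - {{}} = P"
  obtain B0 where B0: "B0 \<in> R" "0 \<in> B0"
    using R by (auto simp: partition_on_def)
  define S where "S = R - {B0}"
  have RS: "R = insert B0 S" "B0 \<notin> S" using B0 by (auto simp: S_def)
  have S: "0 \<notin> C \<and> C \<noteq> {}" if "C \<in> S" for C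
    using R B0 that unfolding S_def partition_on_def disjoint_def by auto
  then have "(\<lambda>B. B - {0}) ` S = (\<lambda>B. B) ` S"
    by (intro image_cong) auto
  moreover have "{} \<notin> S" using S by blast
  ultimately have eq': "P = S \<union> ({B0 - {0}} - {{}})"
    unfolding eq[symmetric] RS(1) by auto
  show "R = add_singleton P \<or> (\<exists>B\<in>P. R = add_to_block P B)"
  proof (cases "B0 = {0}")
    case True
    then show ?thesis using eq' RS by (simp add: add_singleton_def)
  next
    case False
    define B where "B = B0 - {0}"
    have B: "B0 = insert 0 B" "B \<noteq> {}" using B0 False by (auto simp: B_def)
    \<comment> \<open>Needed so that removing \<open>B\<close> from \<open>insert B S\<close> gives
      back \<open>S\<close>.\<close>
    have "B \<notin> S"
    proof
      assume "B \<in> S"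
      then have "B \<inter> B0 = {}"
        using R B0 unfolding S_def partition_on_def disjoint_def by blast
      then show False using B by auto
    qed
    moreover have "P = insert B S"
      using eq' B(2) unfolding B_def[symmetric] by simp
    ultimately show ?thesis using RS(1) B(1) by (auto simp: add_to_block_def)
  qed
next
  have P0: "0 \<notin> B" "B \<noteq> {}" if "B \<in> P" for B
    using P that by (force simp: partition_on_def)+
  have im: "(\<lambda>B. B - {0}) ` S = S" if "S \<subseteq> P" for S
  proof -
    have "(\<lambda>B. B - {0}) ` S = (\<lambda>B. B) ` S" using that P0 by (intro image_cong) auto
    then show ?thesis by simp
  qed
  assume "R = add_singleton P \<or> (\<exists>B\<in>P. R = add_to_block P B)"
  then show "(\<lambda>B. B - {0}) ` R - {{}} = P"
  proof
    assume "R = add_singleton P"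
    then show ?thesis using im[of P] P0(2) by (auto simp: add_singleton_def)
  next
    assume "\<exists>B\<in>P. R = add_to_block P B"
    then obtain B where B: "B \<in> P" "R = add_to_block P B" by blast
    then have "(\<lambda>B. B - {0}) ` R = insert B (P - {B})"
      using im[of "P - {B}"] P0(1) by (simp add: add_to_block_def)
    then show ?thesis using B(1) P0(2) by (auto simp: insert_absorb)
  qed
qed

lemma children_eq:
  assumes P: "P \<in> partitions_of N"
  shows "Collect (is_child P) =
    insert (shift (add_singleton P)) ((\<lambda>B. shift (add_to_block P B)) ` P)"
proof -
  interpret pos_partition "{1..N}" P using P by (rule pos_partitionI)
  have *: "is_child P (shift R) \<longleftrightarrow> R = add_singleton P \<or> (\<exists>B\<in>P. R = add_to_block P B)"
    if R: "partition_on (insert 0 {1..N}) R" for R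
  proof -
    have "is_child P (shift R) \<longleftrightarrow> shift ((\<lambda>B. B - {0}) ` R - {{}}) = shift P"
      unfolding is_child_iff[OF P] using shift_insert_0(1)[OF R] R
      by (subst restrict_shift) (auto simp: partition_on_def)
    then show ?thesis
      unfolding shift_inject using remove_0_eq_iff[OF part R] by simp
  qed
  show ?thesis
  proof (intro set_eqI iffI)
    fix Q assume Q: "Q \<in> Collect (is_child P)"
    then have "Q \<in> partitions_of (N + 1)" using is_child_iff[OF P] by simp
    from ex_shift[OF this] Q show "Q \<in> insert (shift (add_singleton P)) ((\<lambda>B. shift (add_to_block P B)) ` P)"
      using * by auto
  next
    fix Q assume "Q \<in> insert (shift (add_singleton P)) ((\<lambda>B. shift (add_to_block P B)) ` P)"
    then show "Q \<in> Collect (is_child P)"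
      using *[OF partition_on_add_singleton] *[OF partition_on_add_to_block] by auto
  qed
qed

context pos_partition
begin

text \<open>The block containing 0 identifies \<open>B\<close>. Together with
  \<open>add_singleton_neq\<close> this keeps sums over children free of repetitions.\<close>

lemma inj_on_add_to_block: "inj_on (add_to_block P) P"
proof (rule inj_onI)
  fix B C assume BC: "B \<in> P" "C \<in> P" "add_to_block P B = add_to_block P C"
  have "insert 0 B \<in> add_to_block P C"
    unfolding BC(3)[symmetric] by (simp add: add_to_block_def)
  then have "insert 0 B = insert 0 C"
    using block[of "insert 0 B"] unfolding add_to_block_def by blast
  then show "B = C" using block[OF BC(1)] block[OF BC(2)] by (metis insert_ident)
qed

lemma add_singleton_neq: "B \<in> P \<Longrightarrow> add_singleton P \<noteq> add_to_block P B"
proof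
  assume B: "B \<in> P" and "add_singleton P = add_to_block P B"
  then have "{0} \<in> add_to_block P B"
    by (metis add_singleton_def insertI1)
  then show False using block[of "{0}"] block[OF B] unfolding add_to_block_def by auto
qed

end

lemma sum_children:
  fixes g :: "nat set set \<Rightarrow> 'a::comm_monoid_add"
  assumes P: "P \<in> partitions_of N"
  shows "sum g (Collect (is_child P)) =
    g (shift (add_singleton P)) + (\<Sum>B\<in>P. g (shift (add_to_block P B)))"
proof -
  interpret pos_partition "{1..N}" P using P by (rule pos_partitionI)
  have "inj_on (\<lambda>B. shift (add_to_block P B)) P"
    using inj_on_add_to_block by (simp add: inj_on_def shift_inject)
  moreover have "shift (add_singleton P) \<notin> (\<lambda>B. shift (add_to_block P B)) ` P"
    using add_singleton_neq by (auto simp: shift_inject)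
  ultimately show ?thesis
    unfolding children_eq[OF P] by (simp add: finite_P sum.reindex)
qed

lemma is_child_parent_unique:
  assumes "is_child P Q" "is_child P' Q"
  shows "P = P'"
proof -
  obtain N N' where N: "P \<in> partitions_of N" "Q \<in> partitions_of (N + 1)"
    and N': "P' \<in> partitions_of N'" "Q \<in> partitions_of (N' + 1)"
    using assms unfolding is_child_def by blast
  have "N' = N" using partitions_of_unique[OF N(2) N'(2)] by simp
  then have "shift P = shift P'"
    using assms is_child_iff[OF N(1), of Q] is_child_iff[OF N'(1), of Q] by simp
  then show ?thesis by (simp add: shift_inject)
qed

text \<open>Parents are unique because restriction recovers them. Hence distinct children have
  disjoint sets of descendants.\<close>

lemma ancestor_unique:
  "(is_child ^^ l) P Q \<Longrightarrow> (is_child ^^ l) P' Q \<Longrightarrow> P = P'"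
proof (induction l arbitrary: Q)
  case (Suc l)
  then obtain R R' where "(is_child ^^ l) P R" "is_child R Q" "(is_child ^^ l) P' R'" "is_child R' Q"
    by auto
  then show ?case using Suc.IH is_child_parent_unique by metis
qed simp

text \<open>Encodes the multiset of crossing numbers so that unions become sums and added crossings
  become multiplication by a power of q.\<close>

definition descendant_poly :: "nat set set \<Rightarrow> nat \<Rightarrow> nat \<Rightarrow> int poly" where
  "descendant_poly P l m = (\<Sum>Q\<in>descendants P l m. monom 1 (cr Q))"

lemma descendant_poly_0:
  "descendant_poly P 0 m = (if card P = m then monom 1 (cr P) else 0)"
proof -
  have "descendants P 0 m = (if card P = m then {P} else {})"
    by (auto simp: descendants_def)
  then show ?thesis by (simp add: descendant_poly_def)
qed

lemma descendant_poly_Suc: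
  assumes P: "P \<in> partitions_of N"
  shows "descendant_poly P (Suc l) m = (\<Sum>Q\<in>Collect (is_child P). descendant_poly Q l m)"
proof -
  have "descendants P (Suc l) m = (\<Union>Q\<in>Collect (is_child P). descendants Q l m)"
    \<comment> \<open>\<open>relpowp\<close> unfolds at the last generation, whereas the recursion
      splits off the first.\<close>
    unfolding descendants_def relpowp.simps relpowp_commute[symmetric] by auto
  moreover have "finite (Collect (is_child P))"
    unfolding children_eq[OF P]
    using pos_partition.finite_P[OF pos_partitionI[OF P]] by simp
  moreover have "finite (descendants Q l m)" if "is_child P Q" for Q
    using that is_child_iff[OF P] finite_descendants by blast
  moreover have "descendants Q l m \<inter> descendants Q' l m = {}" if "Q \<noteq> Q'" for Q Q'
    using that ancestor_unique unfolding descendants_def by blast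
  ultimately show ?thesis
    unfolding descendant_poly_def by (simp add: sum.UNION_disjoint)
qed

text \<open>Blocks are addressed by the position of their minimum, which matches the index in
  \<open>extension_poly\<close>.\<close>

lemma child_step:
  assumes P: "P \<in> partitions_of N"
  defines "c \<equiv> covering_seq P" and "L \<equiv> sorted_list_of_set (Min ` P)"
  shows "shift (add_singleton P) \<in> partitions_of (Suc N)"
    and "cr (shift (add_singleton P)) = cr P"
    and "covering_seq (shift (add_singleton P)) = 0 # c"
    and "\<And>B. B \<in> P \<Longrightarrow> shift (add_to_block P B) \<in> partitions_of (Suc N)"
    and "\<And>B i. B \<in> P \<Longrightarrow> i < card P \<Longrightarrow> Min B = L ! i \<Longrightarrow>
      cr (shift (add_to_block P B)) = cr P + c ! i \<and>
      covering_seq (shift (add_to_block P B)) = 0 # map Suc (take i c) @ drop (Suc i) c"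
proof -
  interpret pos_partition "{1..N}" P using P by (rule pos_partitionI)
  show "shift (add_singleton P) \<in> partitions_of (Suc N)"
    "covering_seq (shift (add_singleton P)) = 0 # c"
    using shift_insert_0[OF partition_on_add_singleton] by (simp_all add: c_def covering_seq_add_singleton)
  show "cr (shift (add_singleton P)) = cr P"
    by (simp add: cr_shift cr_add_singleton)
  show "shift (add_to_block P B) \<in> partitions_of (Suc N)" if "B \<in> P" for B
    using shift_insert_0(1)[OF partition_on_add_to_block[OF that]] .
  fix B i assume B: "B \<in> P" and i: "i < card P" "Min B = L ! i"
  have len: "length L = card P"
    using length_covering_seq by (simp add: covering_seq_def L_def)
  have c: "c = map (covering P) L" by (simp add: c_def L_def covering_seq_def)
  have "L = take i L @ Min B # drop (Suc i) L"
    using i len by (simp add: id_take_nth_drop)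
  then show "cr (shift (add_to_block P B)) = cr P + c ! i \<and>
      covering_seq (shift (add_to_block P B)) = 0 # map Suc (take i c) @ drop (Suc i) c"
    using covering_seq_add_to_block[OF B, of "take i L" "drop (Suc i) L"]
      shift_insert_0(2)[OF partition_on_add_to_block[OF B]] i len
    by (simp add: cr_shift cr_add_to_block[OF B] c take_map drop_map L_def)
qed

section \<open>The crossing distribution over descendants\<close>

lemma sum_blocks:
  assumes P: "P \<in> partitions_of N"
  shows "(\<Sum>B\<in>P. g (Min B)) = (\<Sum>i<card P. g (sorted_list_of_set (Min ` P) ! i))"
proof -
  interpret pos_partition "{1..N}" P using P by (rule pos_partitionI)
  let ?L = "sorted_list_of_set (Min ` P)"
  have "(\<Sum>B\<in>P. g (Min B)) = sum g (Min ` P)"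
    by (simp add: sum.reindex inj_on_Min)
  also have "\<dots> = sum g (set ?L)" using finite_P by simp
  also have "\<dots> = sum_list (map g ?L)"
    by (simp add: sum_list_distinct_conv_sum_set)
  also have "\<dots> = (\<Sum>i<card P. g (?L ! i))"
    by (simp add: sum_list_sum_nth card_image inj_on_Min atLeast0LessThan)
  finally show ?thesis .
qed

text \<open>Both sides obey the same recursion over children: a join at position \<open>i\<close>
  multiplies by q to the \<open>i\<close>-th covering number and changes the covering sequence as in
  \<open>extension_poly\<close>.\<close>

lemma descendant_poly_eq:
  assumes "P \<in> partitions_of N"
  shows "descendant_poly P l m = monom 1 (cr P) * extension_poly l m (covering_seq P)"
  using assms
proof (induction l arbitrary: P N)
  case 0
  then show ?case
    using pos_partition.length_covering_seq[OF pos_partitionI[OF 0]] by (simp add: descendant_poly_0)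
next
  case (Suc l)
  interpret pos_partition "{1..N}" P using Suc.prems by (rule pos_partitionI)
  let ?c = "covering_seq P" and ?L = "sorted_list_of_set (Min ` P)"
  \<comment> \<open>\<open>sum_blocks\<close> expects a function of the block minimum, so the block
    is recovered by inverting \<open>Min\<close>.\<close>
  define h where "h b = descendant_poly (shift (add_to_block P (the_inv_into P Min b))) l m" for b
  have h: "h (Min B) = descendant_poly (shift (add_to_block P B)) l m" if "B \<in> P" for B
    using that by (simp add: h_def the_inv_into_f_f inj_on_Min)
  have hi: "h (?L ! i) = monom 1 (cr P) * (monom 1 (?c ! i) *
      extension_poly l m (0 # map Suc (take i ?c) @ drop (Suc i) ?c))" if i: "i < card P" for i
  proof -
    have "?L ! i \<in> set ?L"
      using i by (intro nth_mem) (simp add: card_image inj_on_Min)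
    then obtain B where B: "B \<in> P" "Min B = ?L ! i" using finite_P by auto
    show ?thesis
      using child_step(5)[OF Suc.prems B(1) i B(2)] Suc.IH[OF child_step(4)[OF Suc.prems B(1)]]
      by (simp add: h[OF B(1)] flip: B(2) mult.assoc) (simp add: mult_monom)
  qed
  have "descendant_poly P (Suc l) m =
      descendant_poly (shift (add_singleton P)) l m + (\<Sum>B\<in>P. h (Min B))"
    unfolding descendant_poly_Suc[OF Suc.prems] sum_children[OF Suc.prems] by (simp add: h)
  also have "(\<Sum>B\<in>P. h (Min B)) = (\<Sum>i<card P. monom 1 (cr P) * (monom 1 (?c ! i) *
      extension_poly l m (0 # map Suc (take i ?c) @ drop (Suc i) ?c)))"
    unfolding sum_blocks[OF Suc.prems] by (intro sum.cong) (simp_all add: hi)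
  also have "descendant_poly (shift (add_singleton P)) l m =
      monom 1 (cr P) * extension_poly l m (0 # ?c)"
    using Suc.IH[OF child_step(1)[OF Suc.prems]] child_step(2,3)[OF Suc.prems] by simp
  finally show ?case
    by (simp add: length_covering_seq sum_distrib_left distrib_left)
qed

text \<open>Coefficients are multiplicities, so equality of multisets in \<open>cr_equiv\<close>
  becomes equality of polynomials.\<close>

lemma coeff_descendant_poly:
  assumes "P \<in> partitions_of N"
  shows "coeff (descendant_poly P l m) x =
    int (count (image_mset cr (mset_set (descendants P l m))) x)"
proof -
  have "coeff (\<Sum>Q\<in>D. monom (1 :: int) (cr Q)) x = int (count (image_mset cr (mset_set D)) x)"
    if "finite D" for D
    using that by (induction D rule: finite_induct) (simp_all add: count_image_mset)
  then show ?thesis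
    using finite_descendants[OF assms] by (simp add: descendant_poly_def)
qed

lemma cr_equiv_iff_descendant_poly:
  assumes "P \<in> partitions_of n" "Q \<in> partitions_of n"
  shows "cr_equiv P Q \<longleftrightarrow> (\<forall>l m. descendant_poly P l m = descendant_poly Q l m)"
  unfolding cr_equiv_def multiset_eq_iff poly_eq_iff
    coeff_descendant_poly[OF assms(1)] coeff_descendant_poly[OF assms(2)] of_nat_eq_iff ..

text \<open>Keeping the number of blocks excludes the singleton extension; the joins that remain
  gain exactly the entries of \<open>c\<close> as crossings.\<close>

lemma extension_poly_1:
  "extension_poly (Suc 0) (length c) c = (\<Sum>i<length c. monom 1 (c ! i))"
proof -
  have "Suc (min (length c) i + (length c - Suc i)) = length c" if "i < length c" for i
    using that by simp
  then show ?thesis by (auto intro!: sum.cong)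
qed

lemma coeff_sum_monom_nth:
  "coeff (\<Sum>i<length c. monom (1 :: int) (c ! i)) x = int (count (mset c) x)"
proof -
  have "(\<Sum>i<length c. monom (1 :: int) (c ! i)) = (\<Sum>y\<leftarrow>c. monom 1 y)"
    by (simp add: sum_list_sum_nth atLeast0LessThan)
  moreover have "coeff (\<Sum>y\<leftarrow>c. monom (1 :: int) y) x = int (count (mset c) x)"
    by (induction c) auto
  ultimately show ?thesis by simp
qed

lemma cr_equiv_iff:
  assumes P: "P \<in> partitions_with_blocks n k" and Q: "Q \<in> partitions_with_blocks n k"
  shows "cr_equiv P Q \<longleftrightarrow>
    cr P = cr Q \<and> mset (covering_seq P) = mset (covering_seq Q)"
proof
  have p: "P \<in> partitions_of n" "card P = k" and q: "Q \<in> partitions_of n" "card Q = k"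
    using P Q by (auto simp: partitions_with_blocks_def)
  note equiv = cr_equiv_iff_descendant_poly[OF p(1) q(1)]
  show "cr P = cr Q \<and> mset (covering_seq P) = mset (covering_seq Q)" if "cr_equiv P Q"
  proof
    have eq: "descendant_poly P l m = descendant_poly Q l m" for l m
      using that equiv by simp
    show cr: "cr P = cr Q"
      using eq[of 0 k] p q by (simp add: descendant_poly_0 monom_eq_iff')
    have len: "length (covering_seq P) = k" "length (covering_seq Q) = k"
      using pos_partition.length_covering_seq[OF pos_partitionI[OF p(1)]] p(2)
        pos_partition.length_covering_seq[OF pos_partitionI[OF q(1)]] q(2) by simp_all
    \<comment> \<open>The common factor q to the number of crossings cancels at level 1.\<close>
    have "extension_poly (Suc 0) k (covering_seq P) = extension_poly (Suc 0) k (covering_seq Q)"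
      using eq[of "Suc 0" k] cr descendant_poly_eq[OF p(1)] descendant_poly_eq[OF q(1)]
      by (simp add: monom_eq_0_iff del: extension_poly.simps)
    then show "mset (covering_seq P) = mset (covering_seq Q)"
      using len by (metis extension_poly_1 coeff_sum_monom_nth multiset_eqI of_nat_eq_iff)
  qed
  show "cr_equiv P Q" if "cr P = cr Q \<and> mset (covering_seq P) = mset (covering_seq Q)"
    unfolding equiv descendant_poly_eq[OF p(1)] descendant_poly_eq[OF q(1)]
    using that extension_poly_cong_mset by metis
qed

section \<open>Attainable covering numbers and crossings\<close>

text \<open>\<open>reachable a x c\<close>: some partition with \<open>a\<close> arcs and \<open>x\<close> crossings has covering numbers
  \<open>c\<close>.\<close>

inductive reachable :: "nat \<Rightarrow> nat \<Rightarrow> nat list \<Rightarrow> bool" where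
  reachable_Nil: "reachable 0 0 []"
| reachable_Cons: "reachable a x c \<Longrightarrow> reachable a x (0 # c)"
| reachable_join: "reachable a x (p @ v # s) \<Longrightarrow> reachable (Suc a) (x + v) (0 # map Suc p @ s)"

text \<open>Covering sequences satisfy this with \<open>b = 0\<close>, which forces a leading 0; the
  general \<open>b\<close> carries the predecessor through the induction.\<close>

fun step_bounded :: "nat \<Rightarrow> nat list \<Rightarrow> bool" where
  "step_bounded b [] \<longleftrightarrow> True"
| "step_bounded b (x # c) \<longleftrightarrow> x \<le> b \<and> step_bounded (Suc x) c"

lemma step_bounded_mono: "step_bounded b c \<Longrightarrow> b \<le> b' \<Longrightarrow> step_bounded b' c"
  by (cases c) auto

text \<open>Deleting \<open>v\<close> creates no large step: \<open>v\<close> is at most one above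
  its predecessor, and that predecessor is raised by one.\<close>

lemma step_bounded_join:
  "step_bounded b (p @ v # s) \<Longrightarrow> step_bounded (Suc b) (map Suc p @ s)"
  by (induction p arbitrary: b) (auto intro: step_bounded_mono)

lemma step_bounded_split:
  "step_bounded b (p @ v # s) \<Longrightarrow> v \<le> b \<or> (\<exists>y\<in>set p. v \<le> Suc y)"
  by (induction p arbitrary: b) fastforce+

text \<open>A discrete intermediate value argument: a list that climbs by at most one per step skips
  no value.\<close>

lemma step_bounded_down_closed:
  "step_bounded b c \<Longrightarrow> x \<in> set c \<Longrightarrow> b \<le> y \<Longrightarrow> y \<le> x \<Longrightarrow> y \<in> set c"
  by (induction c arbitrary: b) (fastforce simp: not_less_eq_eq le_eq_less_or_eq)+

lemma step_bounded_set_eq: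
  assumes "step_bounded 0 c" "c \<noteq> []"
  shows "set c = {..Max (set c)}"
  using assms step_bounded_down_closed[OF assms(1) Max_in[of "set c"]]
  by (auto intro: Max_ge)

lemma reachable_step_bounded: "reachable a x c \<Longrightarrow> step_bounded 0 c"
proof (induction rule: reachable.induct)
  case (reachable_Cons a x c)
  then show ?case by (auto intro: step_bounded_mono)
next
  case (reachable_join a x p v s)
  then show ?case using step_bounded_join by simp
qed simp

text \<open>The inequality says x \<le> a l - l (l + 1) / 2, doubled to stay in the naturals. A join
  costs at most l crossings and raises the maximum by at most one.\<close>

lemma reachable_bounds:
  assumes "reachable a x c" "c \<noteq> []"
  shows "\<exists>l. set c = {..l} \<and> l \<le> a \<and> 2 * x + l * (l + 1) \<le> 2 * a * l"
  using assms
proof (induction rule: reachable.induct)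
  case (reachable_Cons a x c)
  \<comment> \<open>The induction hypothesis says nothing about the empty list, which only the base
    rule produces.\<close>
  have "a = 0 \<and> x = 0" if "c = []"
    using reachable_Cons.hyps that by cases auto
  then show ?case
    using reachable_Cons.IH by (cases "c = []") (auto simp: insert_absorb)
next
  case (reachable_join a x p v s)
  define c where "c = 0 # map Suc p @ s"
  obtain l where l: "set (p @ v # s) = {..l}" "l \<le> a" "2 * x + l * (l + 1) \<le> 2 * a * l"
    using reachable_join.IH by auto
  have sb: "step_bounded 0 (p @ v # s)"
    using reachable_join.hyps by (rule reachable_step_bounded)
  have "step_bounded 0 c"
    using step_bounded_join[OF sb] by (simp add: c_def)
  then obtain l' where l': "set c = {..l'}"
    using step_bounded_set_eq[of c] by (auto simp: c_def)
  have vl: "v \<le> l"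
    using l(1) by (metis atMost_iff in_set_conv_decomp)
  have "l' \<in> set c" using l' by simp
  then have "l' = 0 \<or> l' \<in> Suc ` set (p @ v # s) \<or> l' \<in> set (p @ v # s)"
    by (auto simp: c_def)
  then have up: "l' \<le> Suc l"
    unfolding l(1) by auto
  have pl': "y < l'" if "y \<in> set p" for y
    using l' that by (force simp: c_def)
  \<comment> \<open>If the deleted \<open>v\<close> is positive, it is at most one above some
    earlier entry, and the join raises that entry.\<close>
  have vl': "v \<le> l'"
    using step_bounded_split[OF sb] pl' by fastforce
  have "l \<in> set (p @ v # s)" using l(1) by simp
  then have low: "l \<le> l'"
    using pl'[of l] vl' l' by (auto simp: c_def)
  have "l' \<le> Suc a \<and> 2 * (x + v) + l' * (l' + 1) \<le> 2 * Suc a * l'"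
  proof (cases "l' = l")
    case True
    then show ?thesis using l vl by simp
  next
    case False
    then have "l' = Suc l" using low up by simp
    \<comment> \<open>The inequality is preserved here because v \<le> l \<le> a.\<close>
    then show ?thesis using l vl by (simp add: algebra_simps)
  qed
  then show ?case using l' unfolding c_def by blast
qed simp

text \<open>The weakly increasing lists with value set \<open>{..l}\<close>.\<close>

inductive staircase :: "nat \<Rightarrow> nat list \<Rightarrow> bool" where
  staircase_base: "staircase 0 [0]"
| staircase_flat: "staircase l c \<Longrightarrow> staircase l (0 # c)"
| staircase_up: "staircase l c \<Longrightarrow> staircase (Suc l) (0 # map Suc c)"

section \<open>Realizing every admissible crossing number\<close>

lemma staircase_snoc_same: "staircase l c \<Longrightarrow> staircase l (c @ [l])"
proof (induction rule: staircase.induct)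
  case staircase_base
  show ?case using staircase.intros(1,2) by fastforce
next
  case (staircase_up l c)
  then show ?case using staircase.staircase_up by fastforce
qed (auto intro: staircase.intros)

lemma staircase_snoc_Suc: "staircase l c \<Longrightarrow> staircase (Suc l) (c @ [Suc l])"
proof (induction rule: staircase.induct)
  case staircase_base
  show ?case using staircase.intros(1) staircase.intros(3) by fastforce
next
  case (staircase_up l c)
  then show ?case using staircase.staircase_up by fastforce
qed (auto intro: staircase.intros)

lemma reachable_replicate: "reachable 0 0 (replicate g 0)"
  by (induction g) (auto intro: reachable.intros)

text \<open>Every join is made at an entry 0 to the right of the staircase, at no cost in crossings.
  The padding supplies these zeros, and the choice of the zero decides whether \<open>w\<close> is
  raised.\<close>

lemma reachable_staircase_noncrossing:
  "staircase r s \<Longrightarrow> w \<le> r \<Longrightarrow> reachable r 0 (s @ w # replicate g 0)"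
proof (induction arbitrary: w g rule: staircase.induct)
  case staircase_base
  then show ?case using reachable_replicate[of "Suc (Suc g)"] by simp
next
  case (staircase_flat l c)
  then show ?case by (auto intro: reachable.intros)
next
  case (staircase_up l c)
  show ?case
  proof (cases w)
    case 0
    have "reachable (Suc l) (0 + 0) (0 # map Suc c @ replicate (Suc g) 0)"
      using staircase_up.IH[of 0 "Suc g"] by (intro reachable_join) simp
    then show ?thesis using 0 by simp
  next
    case (Suc w')
    have "reachable (Suc l) (0 + 0) (0 # map Suc (c @ [w']) @ replicate g 0)"
      using staircase_up.IH[of w' "Suc g"] staircase_up.prems Suc by (intro reachable_join) simp
    then show ?thesis using Suc by simp
  qed
qed

text \<open>A converse of \<open>reachable_bounds\<close>. The outer induction undoes one join; the
  inner one strips leading zeros, which changes neither arcs nor crossings.\<close>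

lemma reachable_staircase:
  assumes "staircase l c" "l \<le> a" "2 * x + l * (l + 1) \<le> 2 * a * l"
  shows "reachable a x c"
  using assms
proof (induction a arbitrary: l c x)
  case 0
  from 0(1) have "set c = {..l}"
    by (induction rule: staircase.induct) (auto simp: image_iff gr0_conv_Suc less_eq_nat.simps
        atMost_Suc_eq_insert_0)
  with 0 have "set c \<subseteq> {0}" "x = 0" by auto
  then show ?case
    using reachable_replicate[of "length c"] by (metis replicate_eqI singletonD subsetD)
next
  case (Suc a)
  note IH = Suc.IH
  from Suc.prems show ?case
  proof (induction arbitrary: x rule: staircase.induct)
    case staircase_base
    have "reachable a 0 ([] @ 0 # [])"
      using IH[of 0 "[0]" 0] by (simp add: staircase.staircase_base)
    from reachable_join[OF this] staircase_base show ?case by simp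
  next
    case (staircase_flat l c)
    then show ?case by (auto intro: reachable.intros)
  next
    case (staircase_up l c)
    \<comment> \<open>\<open>L\<close> is the maximum of the target list. By \<open>top\<close> it
      suffices to find an entry \<open>v\<close> whose deletion by a join at the last block leaves
      an attainable remainder.\<close>
    define L where "L = Suc l"
    have top: "reachable (Suc a) x (0 # map Suc c)" if "reachable a (x - v) (c @ [v])" "v \<le> x" for v
      using reachable_join[of a "x - v" c v "[]"] that by simp
    consider "L \<le> a" "2 * x + L * (L + 1) \<le> 2 * a * L" | "L \<le> a" "2 * x + L * (L + 1) > 2 * a * L"
      | "l = a" "l \<le> x" | "l = a" "x < l"
      using staircase_up.prems L_def by linarith
    then show ?case
    proof cases
      \<comment> \<open>The crossings already fit with one arc fewer, so the last arc is spent on a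
        free join at the first block.\<close>
      case 1
      then have "reachable a x ([] @ 0 # map Suc c)"
        using IH[of L "0 # map Suc c" x] staircase.staircase_up[OF staircase_up.hyps]
        by (simp add: L_def)
      from reachable_join[OF this] show ?thesis by simp
    next
      \<comment> \<open>Too many crossings for \<open>a\<close> arcs: the join takes the largest
        possible cost \<open>L\<close>.\<close>
      case 2
      have "L * L \<le> a * L" using 2(1) by simp
      then have *: "L * (L + 1) + 2 * x > 2 * (L * L)" using 2(2) by linarith
      have "L \<le> x"
      proof (rule ccontr)
        assume "\<not> L \<le> x"
        then have "2 * x + 2 \<le> 2 * L" by simp
        moreover have "2 * (L * L) < L * L + L + 2 * x"
          using * by (simp add: algebra_simps)
        ultimately have "L * L + 2 < 3 * L" by linarith
        \<comment> \<open>No integer lies strictly between 1 and 2; the integers avoid truncated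
          subtraction.\<close>
        then have "(int L - 1) * (int L - 2) < 0"
          by (simp add: algebra_simps flip: of_nat_mult) 
        moreover have "(int L - 1) * (int L - 2) \<ge> 0"
          by (cases "L = 1") (auto simp: L_def)
        ultimately show False by simp
      qed
      moreover have "reachable a (x - L) (c @ [L])"
      proof (rule IH[OF _ 2(1)])
        show "staircase L (c @ [L])"
          using staircase_up.hyps unfolding L_def by (rule staircase_snoc_Suc)
        show "2 * (x - L) + L * (L + 1) \<le> 2 * a * L"
          using staircase_up.prems(2) \<open>L \<le> x\<close> unfolding L_def[symmetric]
          by (simp add: algebra_simps)
      qed
      ultimately show ?thesis by (rule top[rotated])
    next
      \<comment> \<open>The maximum \<open>L\<close> exceeds \<open>a\<close>, so before the join
        only entries up to \<open>l\<close> are possible.\<close>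
      case 3
      have "2 * (x - l) + l * (l + 1) \<le> 2 * a * l"
        using staircase_up.prems(2) 3 by (simp add: algebra_simps)
      then have "reachable a (x - l) (c @ [l])"
        using 3 staircase_snoc_same[OF staircase_up.hyps] by (intro IH) auto
      then show ?thesis using 3 by (intro top)
    next
      \<comment> \<open>One join provides all \<open>x\<close> crossings; the rest is
        noncrossing.\<close>
      case 4
      then have "reachable a (x - x) (c @ [x])"
        using reachable_staircase_noncrossing[OF staircase_up.hyps, of x 0] by simp
      then show ?thesis by (rule top) simp
    qed
  qed
qed

section \<open>Reachable triples are those of partitions\<close>

lemma cr_empty: "cr {} = 0"
  unfolding cr_def arcs_def by (subst card_eq_0_iff) auto

lemma reachable_covering_seq:
  assumes "P \<in> partitions_of n"
  shows "\<exists>a. n = a + card P \<and> reachable a (cr P) (covering_seq P)"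
  using assms
proof (induction n arbitrary: P)
  case 0
  then have "P = {}" by (simp add: partitions_of_def partition_on_empty)
  then show ?case
    by (simp add: covering_seq_def cr_empty reachable_Nil)
next
  case (Suc n)
  obtain R where R: "P = shift R" "partition_on (insert 0 {1..n}) R"
    using ex_shift Suc.prems by auto
  \<comment> \<open>\<open>Q\<close> is the parent of \<open>P\<close>; the way \<open>P\<close>
    extends it selects the rule of \<open>reachable\<close>.\<close>
  define Q where "Q = (\<lambda>B. B - {0}) ` R - {{}}"
  have "partition_on ((insert 0 {1..n}) - {0}) Q"
    unfolding Q_def using R(2) by (rule partition_on_transform) (auto simp: disjnt_def)
  then have Q: "Q \<in> partitions_of n" by (simp add: partitions_of_def)
  have "restrict_partition P {2..n + 1} = shift Q"
    unfolding R(1) Q_def using R(2) by (intro restrict_shift) (simp_all add: partition_on_def)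
  then have "is_child Q P"
    using Suc.prems by (simp add: is_child_iff[OF Q])
  then have P: "P \<in> insert (shift (add_singleton Q)) ((\<lambda>B. shift (add_to_block Q B)) ` Q)"
    using children_eq[OF Q] by blast
  interpret pos_partition "{1..n}" Q using Q by (rule pos_partitionI)
  obtain a where a: "n = a + card Q" "reachable a (cr Q) (covering_seq Q)"
    using Suc.IH[OF Q] by blast
  have len: "card P = length (covering_seq P)"
    using pos_partition.length_covering_seq[OF pos_partitionI[OF Suc.prems]] by simp
  from P consider "P = shift (add_singleton Q)" | B where "B \<in> Q" "P = shift (add_to_block Q B)"
    by auto
  then show ?case
  proof cases
    case 1
    then show ?thesis
      using a len child_step(2,3)[OF Q] length_covering_seq reachable_Cons[OF a(2)] by auto
  next
    case 2
    have "Min B \<in> set (sorted_list_of_set (Min ` Q))" using 2 finite_P by simp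
    then obtain i where i: "i < card Q" "Min B = sorted_list_of_set (Min ` Q) ! i"
      by (auto simp: in_set_conv_nth card_image inj_on_Min)
    note step = child_step(5)[OF Q 2(1) i]
    have "covering_seq Q = take i (covering_seq Q) @ covering_seq Q ! i # drop (Suc i) (covering_seq Q)"
      using i length_covering_seq by (simp add: id_take_nth_drop)
    then have "reachable (Suc a) (cr P) (covering_seq P)"
      using a(2) reachable_join[of a "cr Q" "take i (covering_seq Q)"] step 2(2) by metis
    moreover have "card P = card Q"
      using step 2(2) len i length_covering_seq by simp
    ultimately show ?thesis using a by auto
  qed
qed

lemma reachable_ex_partition:
  assumes "reachable a x c"
  shows "\<exists>P\<in>partitions_of (a + length c). cr P = x \<and> covering_seq P = c"
  using assms
proof (induction rule: reachable.induct)
  case reachable_Nil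
  show ?case
    by (auto simp: partitions_of_def partition_on_empty cr_empty covering_seq_def)
next
  case (reachable_Cons a x c)
  then show ?case using child_step(1-3) by fastforce
next
  case (reachable_join a x p v s)
  then obtain Q where Q: "Q \<in> partitions_of (a + length (p @ v # s))" "cr Q = x"
    and c: "covering_seq Q = p @ v # s" by auto
  interpret pos_partition "{1..a + length (p @ v # s)}" Q using Q(1) by (rule pos_partitionI)
  let ?L = "sorted_list_of_set (Min ` Q)" and ?i = "length p"
  have i: "?i < card Q" using length_covering_seq c by simp
  then have "?L ! ?i \<in> set ?L"
    by (intro nth_mem) (simp add: card_image inj_on_Min)
  then obtain B where B: "B \<in> Q" "Min B = ?L ! ?i" using finite_P by auto
  show ?case
    using child_step(4)[OF Q(1) B(1)] child_step(5)[OF Q(1) B(1) i B(2)] c Q(2)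
    by (intro bexI[of _ "shift (add_to_block Q B)"]) auto
qed

section \<open>Counting the classes\<close>

text \<open>The multiplicities of 0, ..., l form a composition of k into l + 1 positive
  parts.\<close>

definition initial_multisets :: "nat \<Rightarrow> nat \<Rightarrow> nat multiset set" where
  "initial_multisets k l = {M. size M = k \<and> set_mset M = {..l}}"

lemma initial_multisets_1: "initial_multisets (Suc 0) l = (if l = 0 then {{#0#}} else {})"
proof -
  have 1: "{x} = {..l} \<longleftrightarrow> l = 0 \<and> x = 0" for x :: nat
  proof
    assume eq: "{x} = {..l}"
    have "0 \<in> {..l}" "l \<in> {..l}" by auto
    then show "l = 0 \<and> x = 0" unfolding eq[symmetric] by simp
  qed auto
  have 2: "size M = Suc 0 \<longleftrightarrow> (\<exists>x. M = {#x#})" for M :: "nat multiset"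
    by (metis One_nat_def size_1_singleton_mset size_single)
  have "M \<in> initial_multisets (Suc 0) l \<longleftrightarrow> (\<exists>x. M = {#x#} \<and> {x} = {..l})" for M
    unfolding initial_multisets_def mem_Collect_eq 2 by force
  then show ?thesis unfolding 1 by auto
qed

lemma set_mset_image_Suc_eq:
  "set_mset (add_mset 0 (image_mset Suc M)) = {..Suc l} \<longleftrightarrow> set_mset M = {..l}"
proof -
  have "set_mset (add_mset 0 (image_mset Suc M)) = insert 0 (Suc ` set_mset M)" by simp
  moreover have "{..Suc l} = insert 0 (Suc ` {..l})" by (simp add: atMost_Suc_eq_insert_0)
  moreover have "insert 0 (Suc ` A) = insert 0 (Suc ` B) \<longleftrightarrow> A = B" for A B
    by (subst insert_ident) (auto simp: inj_image_eq_iff)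
  ultimately show ?thesis by simp
qed

text \<open>Remove one 0. Either another 0 remains, or all remaining entries are positive and can be
  lowered by one. This is Pascal's rule for the cardinalities.\<close>

lemma initial_multisets_Suc:
  "initial_multisets (Suc (Suc k)) l = add_mset 0 ` initial_multisets (Suc k) l \<union>
     (case l of 0 \<Rightarrow> {} | Suc l' \<Rightarrow>
       (\<lambda>M. add_mset 0 (image_mset Suc M)) ` initial_multisets (Suc k) l')"
  (is "_ = ?A \<union> ?B")
proof (intro equalityI subsetI)
  fix M assume "M \<in> initial_multisets (Suc (Suc k)) l"
  then have M: "size M = Suc (Suc k)" "set_mset M = {..l}"
    by (auto simp: initial_multisets_def)
  then have "0 \<in># M" by simp
  then obtain N where N: "M = add_mset 0 N" by (meson mset_add)
  show "M \<in> ?A \<union> ?B"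
  proof (cases "0 \<in># N")
    case True
    then show ?thesis using M N by (auto simp: initial_multisets_def insert_absorb)
  next
    case False
    have "Suc (x - 1) = x" if "x \<in># N" for x
      using that False by (cases x) auto
    then have "image_mset Suc (image_mset (\<lambda>x. x - 1) N) = N"
      by (simp add: multiset.map_comp comp_def cong: image_mset_cong)
    then obtain N' where N': "N = image_mset Suc N'" by metis
    \<comment> \<open>A further entry is positive, which rules out \<open>l = 0\<close>.\<close>
    then obtain y where "y \<in># N'" using M N by (metis multiset_nonemptyE size_empty
        size_image_mset size_add_mset nat.inject nat.distinct(1))
    then have "Suc y \<in># M" by (simp add: N N')
    then obtain l' where l: "l = Suc l'" using M by (cases l) auto
    then show ?thesis
      using M set_mset_image_Suc_eq[of N' l'] by (auto simp: initial_multisets_def N N')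
  qed
next
  fix M assume "M \<in> ?A \<union> ?B"
  then show "M \<in> initial_multisets (Suc (Suc k)) l"
  proof
    assume "M \<in> ?A"
    then show ?thesis by (auto simp: initial_multisets_def)
  next
    assume "M \<in> ?B"
    then obtain l' N where "l = Suc l'" "N \<in> initial_multisets (Suc k) l'"
      "M = add_mset 0 (image_mset Suc N)" by (auto split: nat.splits)
    then show ?thesis
      using set_mset_image_Suc_eq[of N l'] by (auto simp: initial_multisets_def)
  qed
qed

lemma card_initial_multisets:
  "finite (initial_multisets (Suc k) l) \<and> card (initial_multisets (Suc k) l) = k choose l"
proof (induction k arbitrary: l)
  case 0
  show ?case by (simp add: initial_multisets_1)
next
  case (Suc k)
  show ?case
  proof (cases l)
    case 0
    then show ?thesis
      using Suc.IH[of 0] by (simp add: initial_multisets_Suc card_image inj_on_def)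
  next
    case (Suc l')
    let ?f = "\<lambda>M. add_mset 0 (image_mset Suc M)"
    have "inj ?f"
      using multiset.inj_map[OF inj_Suc] by (simp add: inj_def)
    then have "inj_on ?f (initial_multisets (Suc k) l')"
      by (rule inj_on_subset) simp
    moreover have "inj_on (add_mset 0) (initial_multisets (Suc k) l)"
      by (simp add: inj_on_def)
    moreover have "0 \<in># M" if "M \<in> initial_multisets (Suc k) l" for M
      using that by (simp add: initial_multisets_def)
    then have "add_mset 0 ` initial_multisets (Suc k) l \<inter> ?f ` initial_multisets (Suc k) l' = {}"
      by fastforce
    ultimately show ?thesis
      using Suc.IH[of l] Suc.IH[of l'] Suc
      by (simp add: initial_multisets_Suc card_Un_disjoint card_image)
  qed
qed

text \<open>The recursion for \<open>initial_multisets\<close> mirrors the rules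
  \<open>staircase_flat\<close> and \<open>staircase_up\<close>.\<close>

lemma ex_staircase:
  "M \<in> initial_multisets (Suc k) l \<Longrightarrow> \<exists>c. staircase l c \<and> mset c = M"
proof (induction k arbitrary: l M)
  case 0
  then show ?case
    by (auto simp: initial_multisets_1 split: if_splits intro!: exI[of _ "[0]"] staircase_base)
next
  case (Suc k)
  then consider N where "M = add_mset 0 N" "N \<in> initial_multisets (Suc k) l"
    | l' N where "l = Suc l'" "M = add_mset 0 (image_mset Suc N)" "N \<in> initial_multisets (Suc k) l'"
    unfolding initial_multisets_Suc by (auto split: nat.splits)
  then show ?case
  proof cases
    case 1
    then obtain c where "staircase l c" "mset c = N" using Suc.IH by blast
    then show ?thesis using 1 by (intro exI[of _ "0 # c"]) (auto intro: staircase_flat)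
  next
    case 2
    then obtain c where "staircase l' c" "mset c = N" using Suc.IH by blast
    then show ?thesis using 2 by (intro exI[of _ "0 # map Suc c"]) (auto intro: staircase_up)
  qed
qed

lemma card_quotient_kernel:
  "card (A // {(x, y). x \<in> A \<and> y \<in> A \<and> f x = f y}) = card (f ` A)"
proof -
  let ?g = "\<lambda>v. {y \<in> A. f y = v}"
  let ?r = "{(x, y). x \<in> A \<and> y \<in> A \<and> f x = f y}"
  have "?r `` {x} = ?g (f x)" if "x \<in> A" for x
    using that by auto
  then have "A // ?r = ?g ` f ` A"
    unfolding quotient_def by auto
  moreover have "inj_on ?g (f ` A)"
    by (rule inj_onI) blast
  ultimately show ?thesis by (simp add: card_image)
qed

text \<open>Only the multiset of covering numbers matters, so realizing its weakly increasing
  arrangement suffices.\<close>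

lemma image_cr_covering_seq:
  assumes k: "1 \<le> k" "k \<le> n"
  shows "(\<lambda>P. (cr P, mset (covering_seq P))) ` partitions_with_blocks n k =
    (\<Union>l\<in>{..n - k}. {x. 2 * x + l * (l + 1) \<le> 2 * (n - k) * l} \<times> initial_multisets k l)"
    (is "?f ` _ = ?R")
proof (intro equalityI subsetI)
  fix z assume "z \<in> ?f ` partitions_with_blocks n k"
  then obtain P where P: "P \<in> partitions_of n" "card P = k" "z = ?f P"
    by (auto simp: partitions_with_blocks_def)
  obtain a where a: "n = a + card P" "reachable a (cr P) (covering_seq P)"
    using reachable_covering_seq[OF P(1)] by blast
  have len: "length (covering_seq P) = k"
    using pos_partition.length_covering_seq[OF pos_partitionI[OF P(1)]] P by simp
  then have "covering_seq P \<noteq> []" using k by auto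
  from reachable_bounds[OF a(2) this] show "z \<in> ?R"
    using a P len by (auto simp: initial_multisets_def)
next
  fix z assume "z \<in> ?R"
  then obtain l x M where l: "l \<le> n - k" and x: "2 * x + l * (l + 1) \<le> 2 * (n - k) * l"
    and M: "M \<in> initial_multisets k l" and z: "z = (x, M)" by auto
  obtain c where c: "staircase l c" "mset c = M"
    using ex_staircase[of M "k - 1" l] M k by auto
  have len: "length c = k"
    using M c(2) by (auto simp: initial_multisets_def)
  obtain P where P: "P \<in> partitions_of n" "cr P = x" "covering_seq P = c"
    using reachable_ex_partition[OF reachable_staircase[OF c(1) l x]] len k by auto
  then have "card P = k"
    using pos_partition.length_covering_seq[OF pos_partitionI[OF P(1)]] len by simp
  then show "z \<in> ?f ` partitions_with_blocks n k"
    using P c z by (auto simp: partitions_with_blocks_def)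
qed

text \<open>The set is an initial segment ending at a l - l (l + 1) / 2, where l \<le> a prevents
  truncation; then l (l + 1) / 2 = l + l (l - 1) / 2.\<close>

lemma card_crossing_range:
  assumes "l \<le> a"
  shows "finite {x. 2 * x + l * (l + 1) \<le> 2 * a * l}"
    and "real (card {x. 2 * x + l * (l + 1) \<le> 2 * a * l}) =
      (real a - 1) * real l - real l * (real l - 1) / 2 + 1"
proof -
  define t where "t = l * (l + 1) div 2"
  have t: "l * (l + 1) = 2 * t" by (simp add: t_def)
  have "l * (l + 1) \<le> 2 * (l * l)" by (cases l) auto
  moreover have "l * l \<le> a * l" using assms by simp
  ultimately have le: "t \<le> a * l" using t by linarith
  then have eq: "{x. 2 * x + l * (l + 1) \<le> 2 * a * l} = {..a * l - t}"
    unfolding t by auto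
  then show "finite {x. 2 * x + l * (l + 1) \<le> 2 * a * l}" by simp
  have rt: "real t = real l * (real l + 1) / 2"
    using arg_cong[OF t, of real] by (simp add: field_simps)
  have "real (card {x. 2 * x + l * (l + 1) \<le> 2 * a * l}) = real a * real l - real t + 1"
    unfolding eq using le by (simp add: of_nat_diff)
  also have "\<dots> = (real a - 1) * real l - real l * (real l - 1) / 2 + 1"
    unfolding rt by (simp add: field_simps)
  finally show "real (card {x. 2 * x + l * (l + 1) \<le> 2 * a * l}) =
      (real a - 1) * real l - real l * (real l - 1) / 2 + 1" .
qed

lemma card_classes:
  assumes k: "1 \<le> k" "k \<le> n"
  shows "real (card (partitions_with_blocks n k // cr_rel n k)) =
    (\<Sum>l = 0..min (n - k) (k - 1). real ((k - 1) choose l) *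
      ((real n - real k - 1) * real l - real l * (real l - 1) / 2 + 1))"
proof -
  let ?f = "\<lambda>P. (cr P, mset (covering_seq P))"
  let ?X = "\<lambda>l. {x. 2 * x + l * (l + 1) \<le> 2 * (n - k) * l}"
  have "cr_rel n k = {(P, Q). P \<in> partitions_with_blocks n k \<and> Q \<in> partitions_with_blocks n k \<and>
      ?f P = ?f Q}"
    unfolding cr_rel_def using cr_equiv_iff by auto
  then have "card (partitions_with_blocks n k // cr_rel n k) = card (?f ` partitions_with_blocks n k)"
    using card_quotient_kernel[of _ ?f] by simp
  also have "\<dots> = card (\<Union>l\<in>{..n - k}. ?X l \<times> initial_multisets k l)"
    unfolding image_cr_covering_seq[OF k] ..
  also have "\<dots> = (\<Sum>l\<le>n - k. card (?X l \<times> initial_multisets k l))"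
  proof (rule card_UN_disjoint)
    show "\<forall>l\<in>{..n - k}. finite (?X l \<times> initial_multisets k l)"
      using card_crossing_range(1) card_initial_multisets[of "k - 1"] k by auto
    \<comment> \<open>The value set {..l} of a multiset determines l.\<close>
    show "\<forall>l\<in>{..n - k}. \<forall>l'\<in>{..n - k}. l \<noteq> l' \<longrightarrow>
        (?X l \<times> initial_multisets k l) \<inter> (?X l' \<times> initial_multisets k l') = {}"
      by (auto simp: initial_multisets_def)
  qed simp
  also have "\<dots> = (\<Sum>l\<le>n - k. card (?X l) * ((k - 1) choose l))"
    using card_initial_multisets[of "k - 1"] k by (simp add: card_cartesian_product)
  finally have "real (card (partitions_with_blocks n k // cr_rel n k)) =
      (\<Sum>l\<le>n - k. real (card (?X l)) * real ((k - 1) choose l))"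
    by simp
  also have "\<dots> = (\<Sum>l\<le>n - k. real ((k - 1) choose l) *
      ((real n - real k - 1) * real l - real l * (real l - 1) / 2 + 1))"
    using card_crossing_range(2)[of _ "n - k"] k by (intro sum.cong) (auto simp: of_nat_diff)
  also have "\<dots> = (\<Sum>l = 0..min (n - k) (k - 1). real ((k - 1) choose l) *
      ((real n - real k - 1) * real l - real l * (real l - 1) / 2 + 1))"
    \<comment> \<open>The binomial coefficient vanishes beyond k - 1.\<close>
    by (rule sum.mono_neutral_right) auto
  finally show ?thesis .
qed

section \<open>Closed form of the binomial sum\<close>

lemma sum_choose_Suc:
  fixes f :: "nat \<Rightarrow> real"
  shows "(\<Sum>l\<le>Suc K. real (Suc K choose l) * f l) = (\<Sum>l\<le>K. real (K choose l) * (f l + f (Suc l)))"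
proof -
  have "(\<Sum>l\<le>Suc K. real (Suc K choose l) * f l) =
      f 0 + (\<Sum>l\<le>K. real (K choose Suc l) * f (Suc l)) + (\<Sum>l\<le>K. real (K choose l) * f (Suc l))"
    by (subst sum.atMost_Suc_shift) (simp add: distrib_right sum.distrib)
  also have "f 0 + (\<Sum>l\<le>K. real (K choose Suc l) * f (Suc l)) = (\<Sum>l\<le>Suc K. real (K choose l) * f l)"
    by (subst sum.atMost_Suc_shift) simp
  also have "\<dots> = (\<Sum>l\<le>K. real (K choose l) * f l)" by simp
  finally show ?thesis by (simp add: distrib_left sum.distrib)
qed

text \<open>Combines the factorial moments of order 0, 1 and 2 of a binomial row. The factor 8 keeps
  negative powers of 2 out for small \<open>K\<close>.\<close>

lemma sum_choose_quadratic:
  "8 * (\<Sum>l\<le>K. real (K choose l) * (A * real l - real l * (real l - 1) / 2 + 1)) =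
    (4 * A * K - real K * (real K - 1) + 8) * 2 ^ K"
proof -
  have s0: "(\<Sum>l\<le>K. real (K choose l)) = 2 ^ K" for K
    using choose_row_sum[of K] by (metis of_nat_numeral of_nat_power of_nat_sum)
  have s1: "2 * (\<Sum>l\<le>K. real (K choose l) * real l) = K * 2 ^ K" for K
  proof (induction K)
    case (Suc K)
    have "(\<Sum>l\<le>K. real (K choose l) * (real l + real (Suc l))) =
        2 * (\<Sum>l\<le>K. real (K choose l) * real l) + (\<Sum>l\<le>K. real (K choose l))"
      by (simp add: sum.distrib sum_distrib_left algebra_simps)
    then show ?case
      unfolding sum_choose_Suc using Suc s0[of K] by (simp add: algebra_simps)
  qed simp
  have s2: "4 * (\<Sum>l\<le>K. real (K choose l) * (real l * (real l - 1))) = K * (real K - 1) * 2 ^ K" for K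
  proof (induction K)
    case (Suc K)
    have "(\<Sum>l\<le>K. real (K choose l) * (real l * (real l - 1) + real (Suc l) * (real (Suc l) - 1))) =
        2 * (\<Sum>l\<le>K. real (K choose l) * (real l * (real l - 1))) +
        2 * (\<Sum>l\<le>K. real (K choose l) * real l)"
      unfolding sum_distrib_left sum.distrib[symmetric]
      by (intro sum.cong) (simp_all add: algebra_simps)
    then show ?case
      unfolding sum_choose_Suc using Suc s1[of K] by (simp add: algebra_simps)
  qed simp
  have "(\<Sum>l\<le>K. real (K choose l) * (A * real l - real l * (real l - 1) / 2 + 1)) =
      A * (\<Sum>l\<le>K. real (K choose l) * real l)
      - (\<Sum>l\<le>K. real (K choose l) * (real l * (real l - 1))) / 2 + (\<Sum>l\<le>K. real (K choose l))"
    unfolding sum_distrib_left sum_divide_distrib sum.distrib[symmetric] sum_subtractf[symmetric]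
    by (intro sum.cong) (simp_all add: field_simps)
  then have "8 * (\<Sum>l\<le>K. real (K choose l) * (A * real l - real l * (real l - 1) / 2 + 1)) =
      4 * A * (2 * (\<Sum>l\<le>K. real (K choose l) * real l))
      - 4 * (\<Sum>l\<le>K. real (K choose l) * (real l * (real l - 1))) + 8 * (\<Sum>l\<le>K. real (K choose l))"
    by (simp add: algebra_simps)
  then show ?thesis
    unfolding s0 s1 s2 by (simp add: algebra_simps)
qed

theorem theorem4p5:
  fixes n k m :: nat
  assumes "1 \<le> k" and "k \<le> n" and "m = min (n - k) (k - 1)"
  shows "real (card (partitions_with_blocks n k // cr_rel n k)) =
           (\<Sum>l = 0..m. real ((k - 1) choose l) *
              ((real n - real k - 1) * real l - real l * (real l - 1) / 2 + 1)) \<and>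
         (n \<ge> 2 * k - 1 \<longrightarrow>
         real (card (partitions_with_blocks n k // cr_rel n k)) =
           (real n - real k - 1) * (real k - 1) * 2 powi (int k - 2) + 2 powi (int k - 1)
             - (real k - 1) * (real k - 2) * 2 powi (int k - 4))"
proof (intro conjI impI)
  show main: "real (card (partitions_with_blocks n k // cr_rel n k)) =
      (\<Sum>l = 0..m. real ((k - 1) choose l) *
        ((real n - real k - 1) * real l - real l * (real l - 1) / 2 + 1))"
    unfolding assms(3) using assms(1,2) by (rule card_classes)
  assume "n \<ge> 2 * k - 1"
  \<comment> \<open>Here n - k \<ge> k - 1, so the sum runs over a full binomial row.\<close>
  with assms obtain K where K: "k = Suc K" "m = K" by (cases k) auto
  define S where "S = real (card (partitions_with_blocks n k // cr_rel n k))"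
  have "8 * S = (4 * (real n - real k - 1) * K - real K * (real K - 1) + 8) * 2 ^ K"
    unfolding S_def main sum_choose_quadratic[symmetric] by (simp add: K atLeast0AtMost)
  then have S: "S = (real n - real k - 1) * real K * (2 ^ K / 2) + 2 ^ K
      - real K * (real K - 1) * (2 ^ K / 8)"
    by (simp add: field_simps)
  have "2 powi (int k - 2) = (2 ^ K :: real) / 2"
    using power_int_diff[of "2 :: real" "int K" 1] by (simp add: K)
  moreover have "2 powi (int k - 4) = (2 ^ K :: real) / 8"
    using power_int_diff[of "2 :: real" "int K" 3] by (simp add: K)
  moreover have "2 powi (int k - 1) = (2 ^ K :: real)" "real k - 1 = real K" "real k - 2 = real K - 1"
    by (simp_all add: K)
  ultimately show "real (card (partitions_with_blocks n k // cr_rel n k)) =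
      (real n - real k - 1) * (real k - 1) * 2 powi (int k - 2) + 2 powi (int k - 1)
        - (real k - 1) * (real k - 2) * 2 powi (int k - 4)"
    using S unfolding S_def by (simp only:)
qed

end
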